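(* Let $\mathscr{M}$ be a von Neumann algebra acting on the Hilbert space $\mathcal{H}$, and let $A,B\in\mathscr{M}$ with $\mathrm{null}(B)\subseteq\mathrm{null}(A)$. Then $$(A/B)^* = (B^* )^{\dagger}A^*.$$ Thus for $T\in\mathscr{M}_{\mathrm{aff}}$, its adjoint $T^*$ also lies in $\mathscr{M}_{\mathrm{aff}}$.
   Context: An unbounded operator on $\mathcal{H}$ is a linear map $T:\mathrm{dom}(T)\to\mathcal{H}$ with $\mathrm{dom}(T)$ a (not necessarily dense) linear subspace of $\mathcal{H}$, and $T$ not necessarily bounded; equality of operators includes equality of domains. For $A,B\in\mathcal{B}(\mathcal{H})$ with $\mathrm{null}(B)\subseteq\mathrm{null}(A)$, the quotient $A/B$ is the unbounded operator with domain $\mathrm{ran}(B)$ given by $Bx\mapsto Ax$ ($x\in\mathcal{H}$). $\mathscr{M}_{\mathrm{aff}} := \{A/B : A,B\in\mathscr{M},\ \mathrm{null}(B)\subseteq\mathrm{null}(A)\}$. The Kaufman inverse $T^{\dagger}$ of an unbounded operator $T$ has $\mathrm{dom}(T^{\dagger})=\mathrm{ran}(T)$ and is given by $Tx\mapsto (I-\mathbf{N}(T))x$ ($x\in\mathrm{dom}(T)$), where $\mathbf{N}(T)$ is the orthogonal projection onto $\overline{\mathrm{null}(T)}$. Product of unbounded operators: $\mathrm{dom}(ST)=\{x\in\mathrm{dom}(T): Tx\in\mathrm{dom}(S)\}$, $(ST)x=S(Tx)$. The adjoint of a (not necessarily densely-defined) unbounded operator $T$ on $\mathcal{H}$ is the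 unbounded operator $T^*$ on $\mathcal{H}$ with domain $\{y\in\mathcal{H}: x\mapsto\langle Tx,y\rangle \text{ is continuous on }\mathrm{dom}(T)\}$, where $T^*y$ is the unique $z\in\overline{\mathrm{dom}(T)}$ with $\langle Tx,y\rangle=\langle x,z\rangle$ for all $x\in\mathrm{dom}(T)$. *)

theory Defs
  imports "HOL-Analysis.Analysis"
begin

text \<open>Complex Hilbert spaces. The inner product is linear in its first argument, and its real part
  is the inner product of the underlying real Hilbert space, from which positivity, the norm
  and the topology are inherited.\<close>

class complex_hilbert_space = real_inner + complete_space +
  fixes scaleC :: "complex \<Rightarrow> 'a \<Rightarrow> 'a"  (infixr "*\<^sub>C" 75)
    and cinner :: "'a \<Rightarrow> 'a \<Rightarrow> complex"
  assumes scaleC_add_right: "c *\<^sub>C (x + y) = c *\<^sub>C x + c *\<^sub>C y"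
    and scaleC_add_left: "(c + d) *\<^sub>C x = c *\<^sub>C x + d *\<^sub>C x"
    and scaleC_scaleC: "c *\<^sub>C (d *\<^sub>C x) = (c * d) *\<^sub>C x"
    and scaleC_of_real: "complex_of_real r *\<^sub>C x = r *\<^sub>R x"
    and cinner_add_left: "cinner (x + y) z = cinner x z + cinner y z"
    and cinner_scaleC_left: "cinner (c *\<^sub>C x) y = c * cinner x y"
    and cinner_commute: "cinner x y = cnj (cinner y x)"
    and Re_cinner: "Re (cinner x y) = inner x y"

instantiation complex :: complex_hilbert_space
begin

definition scaleC_complex :: "complex \<Rightarrow> complex \<Rightarrow> complex"
  where "scaleC_complex c x = c * x"

definition cinner_complex :: "complex \<Rightarrow> complex \<Rightarrow> complex"
  where "cinner_complex x y = x * cnj y"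

instance
  by standard
    (simp_all add: scaleC_complex_def cinner_complex_def inner_complex_def algebra_simps
      scaleR_conv_of_real)

end


text \<open>Bounded operators are total functions satisfying the following predicate.\<close>

definition bounded_clinear :: "('a::complex_hilbert_space \<Rightarrow> 'a) \<Rightarrow> bool"
  where "bounded_clinear A \<longleftrightarrow> bounded_linear A \<and> (\<forall>c x. A (c *\<^sub>C x) = c *\<^sub>C A x)"

definition null_space :: "('a::complex_hilbert_space \<Rightarrow> 'a) \<Rightarrow> 'a set"
  where "null_space A = {x. A x = 0}"

definition bounded_adjoint :: "('a::complex_hilbert_space \<Rightarrow> 'a) \<Rightarrow> 'a \<Rightarrow> 'a"
  where "bounded_adjoint A = (THE A'. \<forall>x y. cinner (A x) y = cinner x (A' y))"

text \<open>The weak operator topology on the bounded operators is the initial topology for the maps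
  \<open>A \<mapsto> \<langle>A x, y\<rangle>\<close>; \<open>euclidean\<close> is here the product topology on \<open>'a \<times> 'a \<Rightarrow> complex\<close>.\<close>

definition weak_operator_topology :: "('a::complex_hilbert_space \<Rightarrow> 'a) topology"
  where "weak_operator_topology =
    pullback_topology {A. bounded_clinear A} (\<lambda>A (x, y). cinner (A x) y) euclidean"

definition von_neumann_algebra :: "('a::complex_hilbert_space \<Rightarrow> 'a) set \<Rightarrow> bool"
  where "von_neumann_algebra M \<longleftrightarrow>
    (\<forall>A\<in>M. bounded_clinear A) \<and>
    id \<in> M \<and>
    (\<forall>A\<in>M. \<forall>B\<in>M. (\<lambda>x. A x + B x) \<in> M) \<and>
    (\<forall>c. \<forall>A\<in>M. (\<lambda>x. c *\<^sub>C A x) \<in> M) \<and>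
    (\<forall>A\<in>M. \<forall>B\<in>M. A \<circ> B \<in> M) \<and>
    (\<forall>A\<in>M. bounded_adjoint A \<in> M) \<and>
    closedin weak_operator_topology M"


text \<open>An unbounded operator is represented by a partial map: \<open>dom T\<close> and \<open>ran T\<close> are its domain and
  range, equality includes equality of domains, and the product \<open>S T\<close> is \<open>S \<circ>\<^sub>m T\<close>. A bounded
  operator \<open>A\<close> is the everywhere defined unbounded operator \<open>Some \<circ> A\<close>.\<close>

type_synonym 'a unbounded_op = "'a \<Rightarrow> 'a option"

definition op_null :: "'a::complex_hilbert_space unbounded_op \<Rightarrow> 'a set"
  where "op_null T = {x. T x = Some 0}"

text \<open>The orthogonal projection onto a closed subspace \<open>S\<close>.\<close>

definition orth_proj :: "'a::complex_hilbert_space set \<Rightarrow> 'a \<Rightarrow> 'a"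
  where "orth_proj S x = (THE p. p \<in> S \<and> (\<forall>s\<in>S. cinner (x - p) s = 0))"

definition null_proj :: "'a::complex_hilbert_space unbounded_op \<Rightarrow> 'a \<Rightarrow> 'a"
  where "null_proj T = orth_proj (closure (op_null T))"

definition quotient_op ::
    "('a::complex_hilbert_space \<Rightarrow> 'a) \<Rightarrow> ('a \<Rightarrow> 'a) \<Rightarrow> 'a unbounded_op"
  where "quotient_op A B =
    (\<lambda>y. if y \<in> range B then Some (THE z. \<exists>x. B x = y \<and> z = A x) else None)"

definition kaufman_inverse :: "'a::complex_hilbert_space unbounded_op \<Rightarrow> 'a unbounded_op"
  where "kaufman_inverse T =
    (\<lambda>y. if y \<in> ran T then Some (THE z. \<exists>x. T x = Some y \<and> z = x - null_proj T x) else None)"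

definition op_adjoint :: "'a::complex_hilbert_space unbounded_op \<Rightarrow> 'a unbounded_op"
  where "op_adjoint T =
    (\<lambda>y. if continuous_on (dom T) (\<lambda>x. cinner (the (T x)) y)
         then Some (THE z. z \<in> closure (dom T) \<and>
                           (\<forall>x\<in>dom T. cinner (the (T x)) y = cinner x z))
         else None)"

definition affiliated_quotients ::
    "('a::complex_hilbert_space \<Rightarrow> 'a) set \<Rightarrow> 'a unbounded_op set"
  where "affiliated_quotients M =
    {quotient_op A B | A B. A \<in> M \<and> B \<in> M \<and> null_space B \<subseteq> null_space A}"

end

theory Submission
  imports Defs
begin

text \<open>
  Write \<open>a = A\<^sup>*\<close> and \<open>b = B\<^sup>*\<close>. Both \<open>(A/B)\<^sup>*\<close> and \<open>(B\<^sup>*)\<^sup>\<dagger>A\<^sup>*\<close> send \<open>y\<close> to the unique \<open>z\<close> with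
  \<open>b z = a y\<close> and \<open>z \<bottom> null b\<close>: a functional bounded by a multiple of \<open>\<parallel>B x\<parallel>\<close> is
  \<open>\<langle>B x, z\<rangle>\<close> for some \<open>z\<close> in the closure of \<open>ran B\<close>, which is \<open>(null b)\<^sup>\<bottom>\<close>.

  To write this operator \<open>T\<close> as \<open>C/S\<close> with \<open>C\<close>, \<open>S\<close> in the algebra, let \<open>P\<close> be the projection of
  \<open>H \<oplus> H\<close> onto \<open>{(u, v). a u = b v}\<close> and \<open>P (y, 0) = (E y, F y)\<close>. The entries \<open>E\<close>, \<open>F\<close> lie in the
  algebra because \<open>P\<close> is the strong limit of the even powers of \<open>1 - c K\<^sup>*K\<close>, where
  \<open>K (u, v) = a u - b v\<close> and \<open>c > 0\<close> is small. Put \<open>S = E\<^sup>1\<^sup>/\<^sup>2\<close>. Since \<open>\<parallel>S y\<parallel> = \<parallel>P (y, 0)\<parallel>\<close>, the range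
  of \<open>S\<close> is the first projection of the range of \<open>P\<close>, that is, the domain of \<open>T\<close>. Finally
  \<open>C = T S\<close> satisfies \<open>C S = F\<close>, so \<open>C\<close> is the strong limit of \<open>F S G\<^sub>n\<close>, where
  \<open>E G\<^sub>n = 1 - (1 - E)\<^sup>2\<^sup>n\<close> tends to the projection onto the closure of \<open>ran S\<close>.
\<close>

section \<open>Hilbert space preliminaries\<close>

text \<open>The proof minimises \<open>\<parallel>B x\<parallel>\<^sup>2 - 2 \<phi> x\<close>; the images under \<open>B\<close> of a minimising sequence converge to \<open>z\<close>,
  even when that sequence itself does not converge.\<close>

lemma weak_riesz:
  fixes B :: "'a::real_vector \<Rightarrow> 'b::{real_inner,complete_space}" and \<phi> :: "'a \<Rightarrow> real"
  assumes B: "linear B" and \<phi>: "linear \<phi>"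
    and bound: "\<And>x. \<bar>\<phi> x\<bar> \<le> c * norm (B x)"
  obtains z where "z \<in> closure (range B)" "\<And>x. \<phi> x = inner (B x) z"
proof -
  define J where "J x = (norm (B x))\<^sup>2 - 2 * \<phi> x" for x
  define m where "m = Inf (range J)"
  have "- c\<^sup>2 \<le> J x" for x
  proof -
    have "0 \<le> (norm (B x) - c)\<^sup>2" by simp
    then show ?thesis
      using bound[of x] by (simp add: J_def power2_diff algebra_simps)
  qed
  then have bdd: "bdd_below (range J)"
    by (auto intro!: bdd_belowI[where m = "- c\<^sup>2"])
  have m_le: "m \<le> J x" for x
    unfolding m_def using bdd by (simp add: cInf_lower)
  have "\<exists>x. J x < m + inverse (real (Suc n))" for n
  proof -
    have "Inf (range J) < m + inverse (real (Suc n))" by (simp add: m_def)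
    then show ?thesis
      using bdd by (subst (asm) cInf_less_iff) auto
  qed
  then obtain x where x: "\<And>n. J (x n) < m + inverse (real (Suc n))" by metis
  have Jlim: "(\<lambda>n. J (x n)) \<longlonglongrightarrow> m"
  proof (rule tendsto_sandwich[of "\<lambda>_. m" _ _ "\<lambda>n. m + inverse (real (Suc n))"])
    show "(\<lambda>n. m + inverse (real (Suc n))) \<longlonglongrightarrow> m"
      using tendsto_add[OF tendsto_const LIMSEQ_inverse_real_of_nat] by simp
  qed (use m_le x in \<open>auto intro: less_imp_le always_eventually\<close>)
  \<comment> \<open>The parallelogram law for \<open>B u\<close> and \<open>B v\<close>, with
    \<open>J\<close> at the midpoint bounded below by \<open>m\<close>: images of near-minimisers
    are close together.\<close>
  have par: "(norm (B u - B v))\<^sup>2 \<le> 2 * (J u - m) + 2 * (J v - m)" for u v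
  proof -
    have "B ((1/2) *\<^sub>R (u + v)) = (1/2) *\<^sub>R (B u + B v)"
      and "\<phi> ((1/2) *\<^sub>R (u + v)) = (1/2) * (\<phi> u + \<phi> v)"
      using B \<phi> by (simp_all add: linear_add linear_scale)
    then have "4 * J ((1/2) *\<^sub>R (u + v)) = (norm (B u + B v))\<^sup>2 - 4 * (\<phi> u + \<phi> v)"
      by (simp add: J_def power_divide)
    moreover have "(norm (B u + B v))\<^sup>2 + (norm (B u - B v))\<^sup>2 =
        2 * (norm (B u))\<^sup>2 + 2 * (norm (B v))\<^sup>2"
      by (simp add: power2_norm_eq_inner algebra_simps inner_commute)
    ultimately show ?thesis
      using m_le[of "(1/2) *\<^sub>R (u + v)"] by (simp add: J_def)
  qed
  have "Cauchy (\<lambda>n. B (x n))"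
  proof (rule metric_CauchyI)
    fix e :: real assume "0 < e"
    then have "eventually (\<lambda>n. J (x n) < m + e\<^sup>2 / 4) sequentially"
      using Jlim by (intro order_tendstoD) auto
    then obtain N where N: "\<And>n. N \<le> n \<Longrightarrow> J (x n) < m + e\<^sup>2 / 4"
      by (auto simp: eventually_sequentially)
    have "dist (B (x k)) (B (x n)) < e" if "N \<le> k" "N \<le> n" for k n
    proof -
      have "(norm (B (x k) - B (x n)))\<^sup>2 < e\<^sup>2"
        using par[of "x k" "x n"] N[OF that(1)] N[OF that(2)] by argo
      then show ?thesis
        using \<open>0 < e\<close> power2_less_imp_less by (force simp: dist_norm)
    qed
    then show "\<exists>N. \<forall>k\<ge>N. \<forall>n\<ge>N. dist (B (x k)) (B (x n)) < e" by blast
  qed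
  then obtain z where z: "(\<lambda>n. B (x n)) \<longlonglongrightarrow> z"
    by (auto simp: Cauchy_convergent_iff convergent_def)
  show ?thesis
  proof
    show "z \<in> closure (range B)"
      unfolding closure_sequential using z by (intro exI[of _ "\<lambda>n. B (x n)"]) auto
    fix h
    define d where "d = inner (B h) z - \<phi> h"
    \<comment> \<open>First-order condition at the infimum: \<open>J\<close> is perturbed along
      \<open>h\<close>, and in the limit only \<open>B (x n)\<close> has to converge. A quadratic in
      \<open>t\<close> without constant term that is never negative has linear coefficient zero, so
      \<open>d = 0\<close>.\<close>
    have ineq: "0 \<le> 2 * t * d + t\<^sup>2 * (norm (B h))\<^sup>2" for t
    proof -
      have "J (x n + t *\<^sub>R h) = J (x n) + 2 * t * (inner (B h) (B (x n)) - \<phi> h) + t\<^sup>2 * (norm (B h))\<^sup>2" for n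
        using B \<phi> dot_norm[of "B (x n)" "t *\<^sub>R B h"]
        by (simp add: J_def linear_add linear_scale inner_commute power_mult_distrib algebra_simps)
      then have "m \<le> J (x n) + 2 * t * (inner (B h) (B (x n)) - \<phi> h) + t\<^sup>2 * (norm (B h))\<^sup>2" for n
        by (metis m_le)
      moreover have "(\<lambda>n. J (x n) + 2 * t * (inner (B h) (B (x n)) - \<phi> h) + t\<^sup>2 * (norm (B h))\<^sup>2)
          \<longlonglongrightarrow> m + 2 * t * (inner (B h) z - \<phi> h) + t\<^sup>2 * (norm (B h))\<^sup>2"
        by (intro tendsto_intros Jlim z)
      ultimately have "m \<le> m + 2 * t * (inner (B h) z - \<phi> h) + t\<^sup>2 * (norm (B h))\<^sup>2"
        by (intro LIMSEQ_le_const) auto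
      then show ?thesis by (simp add: d_def)
    qed
    \<comment> \<open>The added 1 keeps \<open>s\<close> positive when \<open>B h = 0\<close>; the
      choice \<open>t = - d / s\<close> then forces \<open>d = 0\<close>.\<close>
    define s where "s = (norm (B h))\<^sup>2 + 1"
    have s: "s > 0" by (simp add: s_def add_nonneg_pos)
    have "2 * (- d / s) * d + (- d / s)\<^sup>2 * (s - 1) = - (d\<^sup>2 * (s + 1)) / s\<^sup>2"
      using s by (simp add: field_simps power2_eq_square)
    moreover have "(norm (B h))\<^sup>2 = s - 1" by (simp add: s_def)
    ultimately have "d\<^sup>2 * (s + 1) \<le> 0"
      using ineq[of "- d / s"] s by (simp add: divide_le_0_iff zero_le_divide_iff)
    then have "d = 0" using s by (simp add: mult_le_0_iff)
    then show "\<phi> h = inner (B h) z" by (simp add: d_def)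
  qed
qed

text \<open>Exponent 2 serves the iterates of a self-adjoint contraction, exponent 1 the majorised
  iteration for square roots.\<close>

lemma Cauchy_if_power_le:
  fixes u :: "nat \<Rightarrow> 'a::real_normed_vector" and g :: "nat \<Rightarrow> real"
  assumes g: "Cauchy g" and k: "0 < k"
    and le: "\<And>m n. m \<le> n \<Longrightarrow> (norm (u n - u m))^k \<le> \<bar>g n - g m\<bar>"
  shows "Cauchy u"
proof (rule metric_CauchyI)
  fix e :: real assume e: "0 < e"
  then obtain N where N: "\<And>m n. N \<le> m \<Longrightarrow> N \<le> n \<Longrightarrow> \<bar>g n - g m\<bar> < e^k"
    using g by (metis Cauchy_iff real_norm_def zero_less_power)
  have near: "norm (u n - u m) < e" if "m \<le> n" "N \<le> m" for m n
  proof (rule power_less_imp_less_base)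
    show "norm (u n - u m) ^ k < e ^ k"
      using le[OF that(1)] N[of m n] that by linarith
  qed (use e in simp)
  then have "dist (u m) (u n) < e" if "N \<le> m" "N \<le> n" for m n
    using near[of m n] near[of n m] that linear[of m n] by (auto simp: dist_norm norm_minus_commute)
  then show "\<exists>N. \<forall>m\<ge>N. \<forall>n\<ge>N. dist (u m) (u n) < e" by blast
qed

text \<open>Self-adjointness makes \<open>inner ((Z ^^ i) x) ((Z ^^ j) x)\<close> depend only on
  \<open>i + j\<close>, so distances between even iterates are controlled by the decreasing squared
  norms. The limit is fixed by the square of \<open>Z\<close>, hence loses no norm, and its defect
  \<open>\<delta> p\<close> vanishes. Even powers are taken because an eigenvalue -1 makes the full
  sequence oscillate.\<close>

lemma selfadjoint_iterates_converge:
  fixes Z :: "'a::{real_inner,complete_space} \<Rightarrow> 'a"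
  assumes Z: "bounded_linear Z" and sa: "\<And>x y. inner (Z x) y = inner x (Z y)"
    and decr: "\<And>x. (norm (Z x))\<^sup>2 + \<delta> x \<le> (norm x)\<^sup>2" and \<delta>: "\<And>x. 0 \<le> \<delta> x"
  obtains p where "(\<lambda>n. (Z ^^ (2 * n)) x) \<longlonglongrightarrow> p" "\<delta> p = 0"
proof -
  define f where "f n = (norm ((Z ^^ n) x))\<^sup>2" for n
  have contr: "norm (Z y) \<le> norm y" for y
  proof (rule power2_le_imp_le)
    show "(norm (Z y))\<^sup>2 \<le> (norm y)\<^sup>2"
      using decr[of y] \<delta>[of y] by linarith
  qed simp
  have f_anti: "decseq f"
    unfolding decseq_Suc_iff f_def by (simp add: contr power_mono)
  have "convergent f"
    using decseq_convergent[OF f_anti, of 0] by (auto simp: f_def convergent_def)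
  then have "Cauchy (\<lambda>n. f (2 * n))"
    using Cauchy_subseq_Cauchy[of f "\<lambda>n. 2 * n"] by (simp add: Cauchy_convergent_iff strict_mono_def o_def)
  moreover have "(norm ((Z ^^ (2 * n)) x - (Z ^^ (2 * m)) x))\<^sup>2 \<le> \<bar>f (2 * n) - f (2 * m)\<bar>"
    if "m \<le> n" for m n
  proof -
    have shift: "inner ((Z ^^ j) u) v = inner u ((Z ^^ j) v)" for j u v
      by (induction j arbitrary: u v) (simp_all add: sa flip: funpow_swap1)
    have f_inner: "inner ((Z ^^ i) x) ((Z ^^ j) x) = f k" if "i + j = 2 * k" for i j k
      using that shift[of i x "(Z ^^ j) x"] shift[of k x "(Z ^^ k) x"]
      by (simp add: f_def power2_norm_eq_inner mult_2 flip: funpow_add[THEN fun_cong, unfolded o_def])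
    have "(norm ((Z ^^ (2 * n)) x - (Z ^^ (2 * m)) x))\<^sup>2 = f (2 * n) - 2 * f (n + m) + f (2 * m)"
      by (simp add: f_inner[of "2*n" "2*n" "2*n"] f_inner[of "2*m" "2*m" "2*m"] f_inner[of "2*n" "2*m" "n+m"]
          power2_norm_eq_inner[of "_ - _"] inner_diff_left inner_diff_right
          inner_commute[of "(Z ^^ (2*m)) x" "(Z ^^ (2*n)) x"])
    moreover have "f (2 * n) \<le> f (n + m)" "f (n + m) \<le> f (2 * m)"
      using that by (auto intro!: decseqD[OF f_anti])
    ultimately show ?thesis by linarith
  qed
  ultimately have "Cauchy (\<lambda>n. (Z ^^ (2 * n)) x)"
    by (rule Cauchy_if_power_le[OF _ pos2])
  then obtain p where p: "(\<lambda>n. (Z ^^ (2 * n)) x) \<longlonglongrightarrow> p"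
    by (auto simp: Cauchy_convergent_iff convergent_def)
  have "(\<lambda>n. Z (Z ((Z ^^ (2 * n)) x))) \<longlonglongrightarrow> Z (Z p)"
    by (intro bounded_linear.tendsto[OF Z] p)
  moreover have "(\<lambda>n. Z (Z ((Z ^^ (2 * n)) x))) \<longlonglongrightarrow> p"
    using LIMSEQ_Suc[OF p] by simp
  ultimately have "Z (Z p) = p" by (rule LIMSEQ_unique)
  then have "norm (Z p) = norm p"
    using contr[of p] contr[of "Z p"] by simp
  then have "\<delta> p = 0" using decr[of p] \<delta>[of p] by simp
  with p show ?thesis by (rule that)
qed

section \<open>Real versus complex inner products; bounded adjoints\<close>

lemma linear_bounded_clinear: "bounded_clinear A \<Longrightarrow> linear A"
  by (simp add: bounded_clinear_def bounded_linear.linear)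

lemma Im_cinner: "Im (cinner x y) = inner (- \<i> *\<^sub>C x) y"
  using Re_cinner[of "- \<i> *\<^sub>C x" y] by (simp add: cinner_scaleC_left)

text \<open>Complex linearity allows the real identity to be used at
  \<open>- \<i> *\<^sub>C x\<close>, which yields the imaginary part. Thus vectors found by the real
  lemma \<open>weak_riesz\<close> also represent complex functionals.\<close>

lemma cinner_eq_if_inner_eq:
  fixes A B :: "'a::complex_hilbert_space \<Rightarrow> 'a"
  assumes "bounded_clinear A" "bounded_clinear B" and eq: "\<And>x. inner (A x) y = inner (B x) z"
  shows "cinner (A x) y = cinner (B x) z"
proof (rule complex_eqI)
  show "Im (cinner (A x) y) = Im (cinner (B x) z)"
    using assms(1,2) eq[of "- \<i> *\<^sub>C x"] by (simp add: Im_cinner bounded_clinear_def)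
qed (simp add: Re_cinner eq)

lemma inner_eq_if_cinner_eq: "cinner x y = cinner u v \<Longrightarrow> inner x y = inner u v"
  by (metis Re_cinner)

lemma bounded_clinear_id: "bounded_clinear id"
  by (simp add: bounded_clinear_def id_def bounded_linear_ident)

lemma bounded_adjoint_eqI:
  assumes "\<And>x y. cinner (A x) y = cinner x (A' y)"
  shows "bounded_adjoint A = A'"
  unfolding bounded_adjoint_def
proof (rule the_equality)
  fix A'' assume "\<forall>x y. cinner (A x) y = cinner x (A'' y)"
  then have "\<forall>x. inner x (A'' y) = inner x (A' y)" for y
    using assms by (metis inner_eq_if_cinner_eq)
  then show "A'' = A'" unfolding vector_eq_ldot by (rule ext)
qed (use assms in blast)

text \<open>\<open>weak_riesz\<close> with the identity as its operator is the usual Riesz theorem;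
  it supplies the adjoint that the definite description asks for.\<close>

lemma cinner_bounded_adjoint:
  assumes A: "bounded_clinear A"
  shows "cinner (A x) y = cinner x (bounded_adjoint A y)"
proof -
  obtain k where k: "\<And>x. norm (A x) \<le> norm x * k"
    using A bounded_linear.bounded unfolding bounded_clinear_def by blast
  have "\<exists>z. \<forall>x. inner (A x) y = inner x z" for y
  proof -
    have "\<bar>inner (A x) y\<bar> \<le> (k * norm y) * norm x" for x
      using Cauchy_Schwarz_ineq2[of "A x" y] mult_right_mono[OF k[of x], of "norm y"]
      by (simp add: algebra_simps)
    moreover have "linear (\<lambda>x. inner (A x) y)"
      using linear_bounded_clinear[OF A]
      by (auto intro!: linearI simp: linear_add linear_scale inner_add_left)
    ultimately obtain z where "\<And>x. inner (A x) y = inner (id x) z"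
      using weak_riesz[of id "\<lambda>x. inner (A x) y" "k * norm y"] by (auto simp: linear_id)
    then show ?thesis by auto
  qed
  then obtain A' where "\<And>x y. inner (A x) y = inner (id x) (A' y)" by (metis id_apply)
  then have A': "cinner (A x) y = cinner x (A' y)" for x y
    using cinner_eq_if_inner_eq[OF A bounded_clinear_id] by simp
  then show ?thesis by (simp add: bounded_adjoint_eqI[OF A'])
qed

lemma inner_bounded_adjoint: "bounded_clinear A \<Longrightarrow> inner (A x) y = inner x (bounded_adjoint A y)"
  by (rule inner_eq_if_cinner_eq) (rule cinner_bounded_adjoint)

lemma bounded_linear_scaleC:
  "bounded_linear (\<lambda>x. c *\<^sub>C (x::'a::complex_hilbert_space))"
proof (rule bounded_linear_intro[where K = "norm c"])
  fix x :: 'a and r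
  show "c *\<^sub>C r *\<^sub>R x = r *\<^sub>R c *\<^sub>C x"
    by (simp add: scaleC_scaleC mult.commute flip: scaleC_of_real)
  have "cinner x (c *\<^sub>C x) = cnj c * cinner x x"
    by (subst (1 2) cinner_commute) (simp add: cinner_scaleC_left)
  then have "cinner (c *\<^sub>C x) (c *\<^sub>C x) = complex_of_real ((cmod c)\<^sup>2) * cinner x x"
    by (simp only: cinner_scaleC_left complex_norm_square mult.assoc)
  then have "Re (cinner (c *\<^sub>C x) (c *\<^sub>C x)) = (cmod c)\<^sup>2 * Re (cinner x x)"
    by (simp only: Re_complex_of_real Im_complex_of_real times_complex.sel mult_zero_left diff_zero)
  then have "(norm (c *\<^sub>C x))\<^sup>2 = (norm x * cmod c)\<^sup>2"
    by (simp add: Re_cinner power2_norm_eq_inner power_mult_distrib mult.commute)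
  then show "norm (c *\<^sub>C x) \<le> norm x * cmod c"
    by (simp add: power2_eq_iff_nonneg)
qed (rule scaleC_add_right)

lemma tendsto_cinner_left:
  assumes "(f \<longlongrightarrow> l) F"
  shows "((\<lambda>x. cinner (f x) y) \<longlongrightarrow> cinner l y) F"
proof -
  have "((\<lambda>x. - \<i> *\<^sub>C f x) \<longlongrightarrow> - \<i> *\<^sub>C l) F"
    by (rule bounded_linear.tendsto[OF bounded_linear_scaleC assms])
  then show ?thesis
    unfolding tendsto_complex_iff Re_cinner Im_cinner
    using assms by (intro conjI tendsto_inner tendsto_const)
qed

section \<open>Strong limits, square roots and projections in a von Neumann algebra\<close>

locale von_neumann =
  fixes M :: "('a::complex_hilbert_space \<Rightarrow> 'a) set"
  assumes von_neumann: "von_neumann_algebra M"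
begin

lemma bounded_clinear_if_mem: "A \<in> M \<Longrightarrow> bounded_clinear A"
  and id_mem: "id \<in> M"
  and add_mem: "A \<in> M \<Longrightarrow> B \<in> M \<Longrightarrow> (\<lambda>x. A x + B x) \<in> M"
  and scaleC_mem: "A \<in> M \<Longrightarrow> (\<lambda>x. c *\<^sub>C A x) \<in> M"
  and adjoint_mem: "A \<in> M \<Longrightarrow> bounded_adjoint A \<in> M"
  using von_neumann by (auto simp: von_neumann_algebra_def)

lemma comp_mem: "A \<in> M \<Longrightarrow> B \<in> M \<Longrightarrow> (\<lambda>x. A (B x)) \<in> M"
  using von_neumann by (auto simp: von_neumann_algebra_def o_def)

lemma linear_if_mem: "A \<in> M \<Longrightarrow> linear A" and bounded_linear_if_mem: "A \<in> M \<Longrightarrow> bounded_linear A"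
  using bounded_clinear_if_mem by (simp_all add: bounded_clinear_def bounded_linear.linear)

lemma scaleR_mem: "A \<in> M \<Longrightarrow> (\<lambda>x. r *\<^sub>R A x) \<in> M"
  using scaleC_mem[of A "complex_of_real r"] by (simp add: scaleC_of_real)

lemma diff_mem: "A \<in> M \<Longrightarrow> B \<in> M \<Longrightarrow> (\<lambda>x. A x - B x) \<in> M"
  using add_mem[of A "\<lambda>x. (- 1) *\<^sub>R B x"] scaleR_mem[of B "- 1"] by simp

lemma zero_mem: "(\<lambda>x. 0) \<in> M"
  using scaleR_mem[OF id_mem, of 0] by simp

lemma self_mem: "(\<lambda>x. x) \<in> M"
  using id_mem by (simp add: id_def)

text \<open>Pointwise convergence makes every \<open>cinner (C n x) y\<close> converge, which is
  convergence in the weak operator topology, where \<open>M\<close> is closed. The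
  \<open>bound\<close> places \<open>L\<close> among the bounded operators.\<close>

lemma strong_limit_mem:
  assumes C: "\<And>n. C n \<in> M" and lim: "\<And>x. (\<lambda>n. C n x) \<longlonglongrightarrow> L x"
    and bound: "\<And>x. norm (L x) \<le> norm x * k"
  shows "L \<in> M"
proof -
  have add: "L (x + y) = L x + L y" for x y
  proof (rule LIMSEQ_unique[OF lim])
    show "(\<lambda>n. C n (x + y)) \<longlonglongrightarrow> L x + L y"
      using tendsto_add[OF lim lim] by (simp add: linear_add[OF linear_if_mem[OF C]])
  qed
  have scaleC: "L (c *\<^sub>C x) = c *\<^sub>C L x" for c x
  proof (rule LIMSEQ_unique[OF lim])
    show "(\<lambda>n. C n (c *\<^sub>C x)) \<longlonglongrightarrow> c *\<^sub>C L x"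
      using bounded_linear.tendsto[OF bounded_linear_scaleC lim[of x], of c] bounded_clinear_if_mem[OF C]
      by (simp add: bounded_clinear_def)
  qed
  have "L (r *\<^sub>R x) = r *\<^sub>R L x" for r x
    using scaleC[of "complex_of_real r" x] by (simp add: scaleC_of_real)
  with add scaleC bound have L: "bounded_clinear L"
    unfolding bounded_clinear_def by (auto intro!: bounded_linear_intro[where K = k])
  define \<Phi> where "\<Phi> = (\<lambda>A::'a \<Rightarrow> 'a. \<lambda>(x, y). cinner (A x) y)"
  have "(\<lambda>n. \<Phi> (C n)) \<longlonglongrightarrow> \<Phi> L"
    using limitin_componentwise[of "\<lambda>_. euclidean" UNIV "\<lambda>n. \<Phi> (C n)" "\<Phi> L" sequentially]
    by (auto simp: euclidean_product_topology \<Phi>_def intro!: tendsto_cinner_left lim)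
  have "limitin weak_operator_topology C L sequentially"
    unfolding limitin_def
  proof (intro conjI allI impI)
    show "L \<in> topspace weak_operator_topology"
      using L by (simp add: weak_operator_topology_def topspace_pullback_topology)
    fix U assume "openin weak_operator_topology U \<and> L \<in> U"
    then obtain V where V: "open V" "U = \<Phi> -` V \<inter> {A. bounded_clinear A}" "\<Phi> L \<in> V"
      by (auto simp: weak_operator_topology_def openin_pullback_topology \<Phi>_def)
    then have "\<forall>\<^sub>F n in sequentially. \<Phi> (C n) \<in> V"
      using \<open>(\<lambda>n. \<Phi> (C n)) \<longlonglongrightarrow> \<Phi> L\<close> topological_tendstoD by blast
    then show "\<forall>\<^sub>F n in sequentially. C n \<in> U"
      by (rule eventually_mono) (simp add: V(2) bounded_clinear_if_mem C)
  qed
  then show ?thesis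
    using von_neumann C limitin_closedin[of weak_operator_topology C L sequentially M]
    by (auto simp: von_neumann_algebra_def)
qed

text \<open>With \<open>S = 1 - L\<close> the equation \<open>S\<^sup>2 = 1 - X\<close> becomes \<open>L = (X + L\<^sup>2) / 2\<close>, solved by iteration from \<open>0\<close>.
  The same recursion on the reals, with \<open>X\<close> replaced by \<open>1\<close>, gives a majorant \<open>t\<close>.\<close>

lemma square_root:
  assumes X: "X \<in> M" and sa: "\<And>x y. inner (X x) y = inner x (X y)"
    and contr: "\<And>x. norm (X x) \<le> norm x"
  obtains S where "S \<in> M" "\<And>x y. inner (S x) y = inner x (S y)" "\<And>x. S (S x) = x - X x"
proof -
  define Y where "Y n = rec_nat (\<lambda>x. 0) (\<lambda>_ Y x. (1/2) *\<^sub>R (X x + Y (Y x))) n" for n :: nat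
  define t where "t n = rec_nat (0::real) (\<lambda>_ r. (1 + r\<^sup>2) / 2) n" for n :: nat
  have Y_simps: "Y 0 = (\<lambda>x. 0)" "Y (Suc n) = (\<lambda>x. (1/2) *\<^sub>R (X x + Y n (Y n x)))" for n
    by (simp_all add: Y_def)
  have t_simps: "t 0 = 0" "t (Suc n) = (1 + (t n)\<^sup>2) / 2" for n
    by (simp_all add: t_def)
  have Y_mem: "Y n \<in> M" for n
    by (induction n) (simp_all add: Y_simps zero_mem scaleR_mem add_mem comp_mem X)
  have t_bounds: "0 \<le> t n \<and> t n \<le> 1" for n
    by (induction n) (auto simp: t_simps power_le_one)
  \<comment> \<open>Each \<open>Y n\<close> is a polynomial in \<open>X\<close>, so it commutes with
    whatever commutes with \<open>X\<close>; this permits factoring a difference of squares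
    below.\<close>
  have commute_Y: "L (Y n x) = Y n (L x)" if "linear L" "\<And>x. L (X x) = X (L x)" for L n x
    by (induction n arbitrary: x) (simp_all add: Y_simps that linear_0 linear_scale linear_add)
  have Y_commute: "Y m (Y n x) = Y n (Y m x)" for m n x
    by (rule commute_Y) (simp_all add: linear_if_mem Y_mem linear_if_mem X commute_Y)
  have Y_norm: "norm (Y n x) \<le> t n * norm x" for n x
  proof (induction n arbitrary: x)
    case (Suc n)
    have "norm (Y n (Y n x)) \<le> t n * (t n * norm x)"
      using Suc[of "Y n x"] mult_left_mono[OF Suc[of x], of "t n"] t_bounds[of n] by linarith
    then have "norm (X x + Y n (Y n x)) \<le> norm x + t n * (t n * norm x)"
      using contr[of x] norm_triangle_ineq[of "X x" "Y n (Y n x)"] by linarith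
    then show ?case by (simp add: Y_simps t_simps power2_eq_square distrib_right mult.assoc)
  qed (simp add: Y_simps t_simps)
  have Y_sa: "inner (Y n x) y = inner x (Y n y)" for n x y
    by (induction n arbitrary: x y) (simp_all add: Y_simps sa inner_add_left inner_add_right)
  \<comment> \<open>\<open>Y\<close> and \<open>t\<close> obey parallel recursions: each new
    difference is half the sum of the two previous terms times their difference, and
    \<open>Y_norm\<close> bounds that sum by the sum of the \<open>t\<close> values.\<close>
  have step: "t n \<le> t (Suc n) \<and> (\<forall>x. norm (Y (Suc n) x - Y n x) \<le> (t (Suc n) - t n) * norm x)" for n
  proof (induction n)
    case 0
    show ?case using contr by (simp add: Y_simps t_simps linear_0 linear_if_mem X)
  next
    case (Suc n)
    have t_eq: "t (Suc (Suc n)) - t (Suc n) = (t (Suc n) + t n) / 2 * (t (Suc n) - t n)"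
    proof -
      have "t (Suc (Suc n)) - t (Suc n) = ((t (Suc n))\<^sup>2 - (t n)\<^sup>2) / 2"
        using t_simps(2)[of "Suc n"] t_simps(2)[of n] by argo
      then show ?thesis by (simp add: power2_eq_square algebra_simps)
    qed
    have nonneg: "0 \<le> t (Suc n) + t n" using t_bounds[of n] t_bounds[of "Suc n"] by simp
    have "norm (Y (Suc (Suc n)) x - Y (Suc n) x) \<le> (t (Suc (Suc n)) - t (Suc n)) * norm x" for x
    proof -
      define d where "d = Y (Suc n) x - Y n x"
      have "Y (Suc (Suc n)) x - Y (Suc n) x = (1/2) *\<^sub>R (Y (Suc n) d + Y n d)"
      proof -
        have "Y (Suc (Suc n)) x - Y (Suc n) x = (1/2) *\<^sub>R (Y (Suc n) (Y (Suc n) x) - Y n (Y n x))"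
          using fun_cong[OF Y_simps(2), of "Suc n" x] fun_cong[OF Y_simps(2), of n x]
          by (simp only: add_diff_cancel_left flip: scaleR_diff_right)
        moreover have "Y (Suc n) d + Y n d = Y (Suc n) (Y (Suc n) x) - Y n (Y n x)"
          by (simp add: d_def linear_diff linear_if_mem Y_mem Y_commute[of n "Suc n"] del: Y_simps)
        ultimately show ?thesis by simp
      qed
      moreover have "norm (Y (Suc n) d + Y n d) \<le> (t (Suc n) + t n) * norm d"
        using norm_triangle_ineq[of "Y (Suc n) d" "Y n d"] Y_norm[of "Suc n" d] Y_norm[of n d]
        by (simp add: distrib_right)
      moreover have "(t (Suc n) + t n) * norm d \<le> (t (Suc n) + t n) * ((t (Suc n) - t n) * norm x)"
        using Suc nonneg by (intro mult_left_mono) (auto simp: d_def)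
      ultimately show ?thesis by (simp add: t_eq)
    qed
    moreover have "t (Suc n) \<le> t (Suc (Suc n))"
      using t_eq nonneg Suc by (metis diff_ge_0_iff_ge divide_nonneg_nonneg mult_nonneg_nonneg zero_le_numeral)
    ultimately show ?case by blast
  qed
  have Y_diff: "norm (Y n x - Y m x) \<le> (t n - t m) * norm x" if "m \<le> n" for m n x
    using that
  proof (induction n rule: dec_induct)
    case (step n)
    then show ?case
      using \<open>\<And>n. t n \<le> t (Suc n) \<and> _\<close>[of n] norm_triangle_ineq[of "Y (Suc n) x - Y n x" "Y n x - Y m x"]
      by (auto simp: algebra_simps dest!: spec[of _ x])
  qed simp
  have "convergent t"
    using incseq_convergent[of t 1] step t_bounds by (metis incseq_SucI convergentI)
  then have "Cauchy (\<lambda>n. t n * norm x)" for x :: 'a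
    by (simp add: Cauchy_convergent_iff convergent_mult convergent_const)
  then have "Cauchy (\<lambda>n. Y n x)" for x
  proof (rule Cauchy_if_power_le[OF _ zero_less_one])
    show "norm (Y n x - Y m x) ^ 1 \<le> \<bar>t n * norm x - t m * norm x\<bar>" if "m \<le> n" for m n
      using Y_diff[OF that, of x] by (simp add: left_diff_distrib)
  qed
  then obtain L where L: "\<And>x. (\<lambda>n. Y n x) \<longlonglongrightarrow> L x"
    unfolding Cauchy_convergent_iff convergent_def by metis
  have Y_contr: "norm (Y n x) \<le> norm x" for n x
    using Y_norm[of n x] mult_right_mono[of "t n" 1 "norm x"] t_bounds[of n] by simp
  have L_contr: "norm (L x) \<le> norm x" for x
    by (rule LIMSEQ_le_const2[OF tendsto_norm[OF L]]) (use Y_contr in auto)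
  have L_mem: "L \<in> M"
    using L_contr by (intro strong_limit_mem[OF Y_mem L, of 1]) simp
  have L_sa: "inner (L x) y = inner x (L y)" for x y
  proof (rule LIMSEQ_unique)
    show "(\<lambda>n. inner (Y n x) y) \<longlonglongrightarrow> inner (L x) y"
      by (intro tendsto_intros L)
    show "(\<lambda>n. inner (Y n x) y) \<longlonglongrightarrow> inner x (L y)"
      unfolding Y_sa by (intro tendsto_intros L)
  qed
  \<comment> \<open>\<open>Y n (Y n x)\<close> is split as
    \<open>Y n (Y n x - L x) + Y n (L x)\<close>; the first term tends to 0 since all
    \<open>Y n\<close> are contractions.\<close>
  have L_sq: "2 *\<^sub>R L x = X x + L (L x)" for x
  proof -
    have "(\<lambda>n. Y n (Y n x - L x)) \<longlonglongrightarrow> 0"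
      by (rule Lim_null_comparison[of _ "\<lambda>n. norm (Y n x - L x)"])
        (use L[of x] in \<open>auto simp: Y_contr tendsto_norm_zero_iff LIM_zero_iff\<close>)
    then have "(\<lambda>n. Y n (Y n x - L x) + Y n (L x)) \<longlonglongrightarrow> 0 + L (L x)"
      by (intro tendsto_add L)
    then have "(\<lambda>n. (1/2) *\<^sub>R (X x + Y n (Y n x))) \<longlonglongrightarrow> (1/2) *\<^sub>R (X x + L (L x))"
      by (intro tendsto_intros) (simp add: linear_diff linear_if_mem Y_mem)
    then have "L x = (1/2) *\<^sub>R (X x + L (L x))"
      using LIMSEQ_unique LIMSEQ_Suc[OF L[of x]] by (simp add: Y_simps)
    then have "2 *\<^sub>R L x = 2 *\<^sub>R (1/2) *\<^sub>R (X x + L (L x))" by (rule arg_cong)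
    then show ?thesis by simp
  qed
  show ?thesis
  proof
    show "(\<lambda>x. x - L x) \<in> M" by (intro diff_mem self_mem L_mem)
    show "inner (x - L x) y = inner x (y - L y)" for x y
      by (simp add: inner_diff_left inner_diff_right L_sa)
    show "x - L x - L (x - L x) = x - X x" for x
      using L_sq[of x] by (simp add: linear_diff linear_if_mem L_mem algebra_simps scaleR_2)
  qed
qed

section \<open>Projections onto null spaces and parametrisation of a graph\<close>

lemma funpow_mem: "A \<in> M \<Longrightarrow> A ^^ n \<in> M"
  by (induction n) (auto simp: id_mem o_def intro: comp_mem)

text \<open>\<open>E\<close> and \<open>F\<close> form the first column of the projection onto the
  null space of \<open>K (u, v) = a u - b v\<close>. The last conclusion says that
  \<open>(y, 0) - (E y, F y)\<close> is orthogonal to that null space.\<close>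

lemma null_projection_entries:
  assumes mem: "a \<in> M" "a' \<in> M" "b \<in> M" "b' \<in> M"
    and a': "\<And>x y. inner (a x) y = inner x (a' y)" and b': "\<And>x y. inner (b x) y = inner x (b' y)"
  obtains E F where "E \<in> M" "F \<in> M" "\<And>y. a (E y) = b (F y)"
    "\<And>y u v. a u = b v \<Longrightarrow> inner (E y) u + inner (F y) v = inner y u"
proof -
  note lin = linear_if_mem[OF mem(1)] linear_if_mem[OF mem(2)] linear_if_mem[OF mem(3)] linear_if_mem[OF mem(4)]
  note blin = bounded_linear_if_mem[OF mem(1)] bounded_linear_if_mem[OF mem(2)]
    bounded_linear_if_mem[OF mem(3)] bounded_linear_if_mem[OF mem(4)]
  obtain ka where ka: "\<And>x. norm (a' x) \<le> norm x * ka"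
    using bounded_linear.bounded[OF blin(2)] by blast
  obtain kb where kb: "\<And>x. norm (b' x) \<le> norm x * kb"
    using bounded_linear.bounded[OF blin(4)] by blast
  \<comment> \<open>Small enough that \<open>c\<close> times \<open>K\<close> times its adjoint is
    at most 1; the added 1 avoids division by zero.\<close>
  define c where "c = 1 / (ka\<^sup>2 + kb\<^sup>2 + 1)"
  have pos: "0 < ka\<^sup>2 + kb\<^sup>2 + 1" by (simp add: add_nonneg_pos)
  then have c: "0 < c" by (simp add: c_def)
  have c_bound: "c * ((norm (a' w))\<^sup>2 + (norm (b' w))\<^sup>2) \<le> (norm w)\<^sup>2" for w
  proof -
    have "(norm (a' w))\<^sup>2 \<le> (norm w * ka)\<^sup>2" "(norm (b' w))\<^sup>2 \<le> (norm w * kb)\<^sup>2"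
      using ka kb by (simp_all add: power_mono)
    then have "(norm (a' w))\<^sup>2 + (norm (b' w))\<^sup>2 \<le> (norm w)\<^sup>2 * (ka\<^sup>2 + kb\<^sup>2 + 1)"
      by (simp add: power_mult_distrib distrib_left add_increasing2)
    then show ?thesis using pos by (simp add: c_def pos_divide_le_eq)
  qed
  define K where "K p = a (fst p) - b (snd p)" for p
  \<comment> \<open>The adjoint of \<open>K\<close> sends \<open>w\<close> to
    \<open>(a' w, - b' w)\<close>, whence the plus sign in the second coordinate.\<close>
  define Z where "Z p = (fst p - c *\<^sub>R a' (K p), snd p + c *\<^sub>R b' (K p))" for p
  have K: "bounded_linear K"
    unfolding K_def
    by (intro bounded_linear_sub bounded_linear_compose[OF blin(1)] bounded_linear_compose[OF blin(3)]
        bounded_linear_fst bounded_linear_snd)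
  have Z: "bounded_linear Z"
    unfolding Z_def
    by (intro bounded_linear_Pair bounded_linear_sub bounded_linear_add bounded_linear_fst bounded_linear_snd
        bounded_linear_const_scaleR bounded_linear_compose[OF blin(2)] bounded_linear_compose[OF blin(4)] K)
  have Z_inner: "inner (Z p) q = inner p q - c * inner (K p) (K q)" for p q
  proof -
    have "inner (a' w) x = inner w (a x)" "inner (b' w) x = inner w (b x)" for w x
      by (metis a' inner_commute) (metis b' inner_commute)
    then show ?thesis
      by (simp add: Z_def K_def[of q] inner_prod_def inner_add_left inner_diff_left inner_diff_right algebra_simps)
  qed
  then have sa: "inner (Z p) q = inner p (Z q)" for p q
    by (metis inner_commute)
  \<comment> \<open>The loss of norm rests on \<open>inner (K (Z p)) (K p)\<close> being
    nonnegative, which is \<open>c_bound\<close> at \<open>w = K p\<close>.\<close>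
  have decr: "(norm (Z p))\<^sup>2 + c * (norm (K p))\<^sup>2 \<le> (norm p)\<^sup>2" for p
  proof -
    have "K (Z p) = K p - c *\<^sub>R (a (a' (K p)) + b (b' (K p)))"
      by (simp add: K_def Z_def lin linear_diff linear_add linear_scale algebra_simps)
    then have "inner (K (Z p)) (K p) = (norm (K p))\<^sup>2 - c * ((norm (a' (K p)))\<^sup>2 + (norm (b' (K p)))\<^sup>2)"
      by (simp add: inner_diff_left inner_add_left a' b' power2_norm_eq_inner)
    moreover have "(norm (Z p))\<^sup>2 = (norm p)\<^sup>2 - c * (norm (K p))\<^sup>2 - c * inner (K (Z p)) (K p)"
      using Z_inner[of p "Z p"] Z_inner[of p p] sa[of p p] by (simp add: power2_norm_eq_inner inner_commute)
    moreover have "0 \<le> c * ((norm (K p))\<^sup>2 - c * ((norm (a' (K p)))\<^sup>2 + (norm (b' (K p)))\<^sup>2))"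
      using c c_bound[of "K p"] by simp
    ultimately show ?thesis by simp
  qed
  have lim_ex: "\<exists>p. (\<lambda>n. (Z ^^ (2 * n)) (y, 0)) \<longlonglongrightarrow> p \<and> K p = 0" for y
  proof -
    have "0 \<le> c * (norm (K p))\<^sup>2" for p using c by simp
    then obtain p where "(\<lambda>n. (Z ^^ (2 * n)) (y, 0)) \<longlonglongrightarrow> p" "c * (norm (K p))\<^sup>2 = 0"
      using selfadjoint_iterates_converge[OF Z sa decr, of "(y, 0)"] by blast
    then show ?thesis using c by (intro exI[of _ p]) simp
  qed
  then obtain P where P: "\<And>y. (\<lambda>n. (Z ^^ (2 * n)) (y, 0)) \<longlonglongrightarrow> P y" "\<And>y. K (P y) = 0"
    by metis
  define E where "E = (\<lambda>y. fst (P y))"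
  define F where "F = (\<lambda>y. snd (P y))"
  have ab: "a (E y) = b (F y)" for y
    using P(2)[of y] by (simp add: K_def E_def F_def)
  have orth: "inner (E y) u + inner (F y) v = inner y u" if "a u = b v" for y u v
  proof -
    \<comment> \<open>Here \<open>K (u, v) = 0\<close>, so by \<open>Z_inner\<close> no application
      of \<open>Z\<close> changes the inner product with \<open>(u, v)\<close>.\<close>
    have "inner ((Z ^^ n) p) (u, v) = inner p (u, v)" for n p
      using that by (induction n) (simp_all add: Z_inner K_def[of "(u, v)"])
    then have "(\<lambda>n. inner (y, 0) (u, v)) \<longlonglongrightarrow> inner (P y) (u, v)"
      using tendsto_inner[OF P(1)[of y] tendsto_const[of "(u, v)"]] by simp
    then have "inner (P y) (u, v) = inner (y, 0) (u, v)"
      by (simp add: LIMSEQ_const_iff)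
    then show ?thesis by (simp add: E_def F_def inner_prod_def)
  qed
  have norm_sq: "(norm (E y))\<^sup>2 + (norm (F y))\<^sup>2 = inner y (E y)" for y
    using orth[OF ab[of y]] by (simp add: power2_norm_eq_inner)
  have E_le: "norm (E y) \<le> norm y" for y
  proof -
    have "norm (E y) * norm (E y) \<le> norm y * norm (E y)"
      using norm_sq[of y] norm_cauchy_schwarz[of y "E y"] zero_le_power2[of "norm (F y)"]
      unfolding power2_eq_square by linarith
    then show ?thesis by (cases "norm (E y) = 0") simp_all
  qed
  have F_le: "norm (F y) \<le> norm y" for y
  proof (rule power2_le_imp_le)
    show "(norm (F y))\<^sup>2 \<le> (norm y)\<^sup>2"
      using norm_sq[of y] norm_cauchy_schwarz[of y "E y"] zero_le_power2[of "norm (E y)"]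
        mult_left_mono[OF E_le[of y] norm_ge_zero[of y]]
      unfolding power2_eq_square by linarith
  qed simp
  \<comment> \<open>On vectors \<open>(y, 0)\<close>, both coordinates of an iterate are polynomials
    in \<open>a\<close>, \<open>a'\<close>, \<open>b\<close>, \<open>b'\<close> applied to
    \<open>y\<close>.\<close>
  have "\<exists>E F. E \<in> M \<and> F \<in> M \<and> (\<forall>y. (Z ^^ n) (y, 0) = (E y, F y))" for n
  proof (induction n)
    case 0
    show ?case using self_mem zero_mem by fastforce
  next
    case (Suc n)
    then obtain E F where EF: "E \<in> M" "F \<in> M" "\<And>y. (Z ^^ n) (y, 0) = (E y, F y)" by blast
    have "(\<lambda>y. E y - c *\<^sub>R a' (a (E y) - b (F y))) \<in> M" "(\<lambda>y. F y + c *\<^sub>R b' (a (E y) - b (F y))) \<in> M"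
      by (intro diff_mem add_mem scaleR_mem comp_mem[OF mem(2)] comp_mem[OF mem(4)]
          comp_mem[OF mem(1)] comp_mem[OF mem(3)] EF)+
    moreover have "(Z ^^ Suc n) (y, 0) =
        (E y - c *\<^sub>R a' (a (E y) - b (F y)), F y + c *\<^sub>R b' (a (E y) - b (F y)))" for y
      by (simp add: EF(3)) (simp add: Z_def K_def)
    ultimately show ?case by blast
  qed
  then obtain En Fn where EFn: "\<And>n. En n \<in> M" "\<And>n. Fn n \<in> M" "\<And>n y. (Z ^^ n) (y, 0) = (En n y, Fn n y)"
    by metis
  have "E \<in> M"
  proof (rule strong_limit_mem[OF EFn(1)])
    show "(\<lambda>n. En (2 * n) y) \<longlonglongrightarrow> E y" for y
      using tendsto_fst[OF P(1)[of y]] by (simp add: EFn(3) E_def)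
    show "norm (E y) \<le> norm y * 1" for y using E_le by simp
  qed
  moreover have "F \<in> M"
  proof (rule strong_limit_mem[OF EFn(2)])
    show "(\<lambda>n. Fn (2 * n) y) \<longlonglongrightarrow> F y" for y
      using tendsto_snd[OF P(1)[of y]] by (simp add: EFn(3) F_def)
    show "norm (F y) \<le> norm y * 1" for y using F_le by simp
  qed
  ultimately show ?thesis using that ab orth by blast
qed

text \<open>\<open>S\<close> and \<open>C\<close> become denominator and numerator of the adjoint.
  Formally \<open>C\<close> is \<open>F\<close> times the inverse of \<open>S\<close>; the limit
  construction makes sense of this when \<open>S\<close> is not invertible.\<close>

lemma graph_parametrization:
  assumes mem: "a \<in> M" "a' \<in> M" "b \<in> M" "b' \<in> M"
    and a': "\<And>x y. inner (a x) y = inner x (a' y)" and b': "\<And>x y. inner (b x) y = inner x (b' y)"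
  obtains S C where "S \<in> M" "C \<in> M" "\<And>x. a (S x) = b (C x)"
    "\<And>x n. b n = 0 \<Longrightarrow> inner (C x) n = 0"
    "\<And>y z. a y = b z \<Longrightarrow> y \<in> range S"
proof -
  obtain E F where E: "E \<in> M" and F: "F \<in> M" and ab: "\<And>y. a (E y) = b (F y)"
    and orth: "\<And>y u v. a u = b v \<Longrightarrow> inner (E y) u + inner (F y) v = inner y u"
    using null_projection_entries[OF mem a' b'] by metis
  note lin = linear_if_mem[OF E] linear_if_mem[OF F] linear_if_mem[OF mem(1)] linear_if_mem[OF mem(3)]
  have E_inner: "inner y (E y') = inner (E y) (E y') + inner (F y) (F y')" for y y'
    using orth[OF ab[of y'], of y] by simp
  then have E_sa: "inner (E y) y' = inner y (E y')" for y y'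
    by (metis inner_commute)
  have norm_sq: "(norm (E y))\<^sup>2 + (norm (F y))\<^sup>2 = inner y (E y)" for y
    by (simp add: E_inner[of y y] power2_norm_eq_inner)
  define Z where "Z = (\<lambda>x. x - E x)"
  have Z: "Z \<in> M" unfolding Z_def by (intro diff_mem self_mem E)
  have Z_sa: "inner (Z x) y = inner x (Z y)" for x y
    by (simp add: Z_def inner_diff_left inner_diff_right E_sa)
  \<comment> \<open>Rests on \<open>E\<close> squared being at most \<open>E\<close>, true for a
    corner of a projection.\<close>
  have decr: "(norm (Z y))\<^sup>2 + inner y (E y) \<le> (norm y)\<^sup>2" for y
  proof -
    have "(norm (Z y))\<^sup>2 = (norm y)\<^sup>2 - 2 * inner y (E y) + (norm (E y))\<^sup>2"
      by (simp add: Z_def power2_norm_eq_inner inner_diff_left inner_diff_right inner_commute)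
    then show ?thesis using norm_sq[of y] zero_le_power2[of "norm (F y)"] by linarith
  qed
  have E_pos: "0 \<le> inner y (E y)" for y
    by (simp flip: norm_sq)
  have Z_le: "norm (Z y) \<le> norm y" for y
  proof (rule power2_le_imp_le)
    show "(norm (Z y))\<^sup>2 \<le> (norm y)\<^sup>2" using decr[of y] E_pos[of y] by linarith
  qed simp
  have Zn_le: "norm ((Z ^^ n) y) \<le> norm y" for n y
    by (induction n) (auto intro: order_trans[OF Z_le])
  obtain S where S: "S \<in> M" and S_sa: "\<And>x y. inner (S x) y = inner x (S y)"
    and S_sq: "\<And>x. S (S x) = x - Z x"
    using square_root[OF Z Z_sa Z_le] by metis
  have SS: "S (S x) = E x" for x by (simp add: S_sq Z_def)
  have S_norm: "(norm (S y))\<^sup>2 = inner y (E y)" for y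
    by (simp add: power2_norm_eq_inner S_sa SS)
  \<comment> \<open>Convergence of \<open>E (G n x)\<close> thereby passes to
    \<open>F (S (G n x))\<close>, although \<open>G n x\<close> itself need not converge.\<close>
  have F_S_le: "norm (F (S d)) \<le> norm (E d)" for d
  proof (rule power2_le_imp_le)
    have "(norm (F (S d)))\<^sup>2 \<le> (norm (S (S d)))\<^sup>2"
      using norm_sq[of "S d"] zero_le_power2[of "norm (E (S d))"] unfolding S_norm by linarith
    then show "(norm (F (S d)))\<^sup>2 \<le> (norm (E d))\<^sup>2" by (simp only: SS)
  qed simp
  \<comment> \<open>Approximate inverses of \<open>E = 1 - Z\<close>: adding \<open>1 + Z\<close>
    applied to \<open>(Z ^^ (2 * n)) x\<close> raises the power of \<open>Z\<close> in the remainder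
    by two.\<close>
  have "\<exists>G. G \<in> M \<and> (\<forall>x. E (G x) = x - (Z ^^ (2 * n)) x)" for n
  proof (induction n)
    case 0
    show ?case using zero_mem by (intro exI[of _ "\<lambda>x. 0"]) (simp add: linear_0 lin)
  next
    case (Suc n)
    then obtain G where G: "G \<in> M" "\<And>x. E (G x) = x - (Z ^^ (2 * n)) x" by blast
    have "(\<lambda>x. G x + ((Z ^^ (2 * n)) x + Z ((Z ^^ (2 * n)) x))) \<in> M"
      by (intro add_mem G funpow_mem Z comp_mem[OF Z])
    moreover have "E (G x + ((Z ^^ (2 * n)) x + Z ((Z ^^ (2 * n)) x))) = x - (Z ^^ (2 * Suc n)) x" for x
    proof -
      have "(Z ^^ (2 * Suc n)) x = Z (Z ((Z ^^ (2 * n)) x))" by simp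
      then show ?thesis
        by (simp add: linear_add linear_diff lin G(2)) (simp add: Z_def linear_diff lin)
    qed
    ultimately show ?case by blast
  qed
  then obtain G where G: "\<And>n. G n \<in> M" "\<And>n x. E (G n x) = x - (Z ^^ (2 * n)) x"
    by metis
  have FS_mem: "(\<lambda>x. F (S (G n x))) \<in> M" for n
    by (intro comp_mem[OF F] comp_mem[OF S] G)
  have Z_lim: "\<exists>p. (\<lambda>n. (Z ^^ (2 * n)) x) \<longlonglongrightarrow> p \<and> S p = 0" for x
  proof -
    obtain p where "(\<lambda>n. (Z ^^ (2 * n)) x) \<longlonglongrightarrow> p" "inner p (E p) = 0"
      using selfadjoint_iterates_converge[OF bounded_linear_if_mem[OF Z] Z_sa decr E_pos] by blast
    then show ?thesis using S_norm[of p] by auto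
  qed
  have "convergent (\<lambda>n. F (S (G n x)))" for x
  proof -
    have "Cauchy (\<lambda>n. (Z ^^ (2 * n)) x)"
      using Z_lim[of x] by (auto simp: Cauchy_convergent_iff convergent_def)
    moreover have "norm (F (S (G m x)) - F (S (G n x))) \<le> norm ((Z ^^ (2 * m)) x - (Z ^^ (2 * n)) x)" for m n
      using F_S_le[of "G m x - G n x"]
      by (simp add: linear_diff lin linear_if_mem[OF S] G(2) norm_minus_commute)
    ultimately have "Cauchy (\<lambda>n. F (S (G n x)))"
      unfolding Cauchy_iff by (meson order.strict_trans1)
    then show ?thesis by (simp add: Cauchy_convergent_iff)
  qed
  then obtain C where C: "\<And>x. (\<lambda>n. F (S (G n x))) \<longlonglongrightarrow> C x"
    unfolding convergent_def by metis
  have C_mem: "C \<in> M"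
  proof (rule strong_limit_mem[OF FS_mem C])
    fix x
    have "norm (F (S (G n x))) \<le> norm x * 2" for n
      using F_S_le[of "G n x"] norm_triangle_ineq4[of x "(Z ^^ (2 * n)) x"] Zn_le[of "2 * n" x]
      by (simp add: G(2))
    then show "norm (C x) \<le> norm x * 2"
      by (intro LIMSEQ_le_const2[OF tendsto_norm[OF C]]) auto
  qed
  show ?thesis
  proof (rule that[OF S C_mem])
    fix x
    obtain p where p: "(\<lambda>n. (Z ^^ (2 * n)) x) \<longlonglongrightarrow> p" "S p = 0" using Z_lim by blast
    \<comment> \<open>\<open>S\<close> commutes with its square \<open>E\<close>, and the remainder
      tends to \<open>p\<close>, which \<open>S\<close> annihilates.\<close>
    have "E (S (G n x)) = S (x - (Z ^^ (2 * n)) x)" for n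
      by (simp only: G(2)[symmetric] SS[symmetric])
    moreover have "(\<lambda>n. S (x - (Z ^^ (2 * n)) x)) \<longlonglongrightarrow> S (x - p)"
      by (intro bounded_linear.tendsto[OF bounded_linear_if_mem[OF S]] tendsto_intros p)
    ultimately have "(\<lambda>n. E (S (G n x))) \<longlonglongrightarrow> S x"
      using p(2) by (simp add: linear_diff linear_if_mem[OF S])
    then have "(\<lambda>n. a (E (S (G n x)))) \<longlonglongrightarrow> a (S x)"
      by (intro bounded_linear.tendsto[OF bounded_linear_if_mem[OF mem(1)]])
    moreover have "(\<lambda>n. b (F (S (G n x)))) \<longlonglongrightarrow> b (C x)"
      by (intro bounded_linear.tendsto[OF bounded_linear_if_mem[OF mem(3)]] C)
    ultimately show "a (S x) = b (C x)"
      unfolding ab by (rule LIMSEQ_unique)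
  next
    fix x n assume "b n = 0"
    then have "inner (F y) n = 0" for y
      using orth[of 0 n y] by (simp add: linear_0 lin)
    then have "(\<lambda>_. 0) \<longlonglongrightarrow> inner (C x) n"
      using tendsto_inner[OF C[of x] tendsto_const[of n]] by simp
    then show "inner (C x) n = 0" by (simp add: LIMSEQ_const_iff)
  next
    \<comment> \<open>By \<open>orth\<close>, \<open>inner u y\<close> is the inner product of
      \<open>(E u, F u)\<close> with \<open>(y, z)\<close>, and both \<open>E u\<close> and
      \<open>F u\<close> are bounded by \<open>S u\<close>. So \<open>weak_riesz\<close> for
      \<open>S\<close> solves \<open>y = S w\<close>.\<close>
    fix y z assume yz: "a y = b z"
    have "\<bar>inner u y\<bar> \<le> (norm y + norm z) * norm (S u)" for u
    proof -
      have "norm (E u) \<le> norm (S u)" "norm (F u) \<le> norm (S u)"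
        by (rule power2_le_imp_le; simp add: S_norm flip: norm_sq)+
      then have "norm (E u) * norm y + norm (F u) * norm z \<le> (norm y + norm z) * norm (S u)"
        by (simp add: distrib_left distrib_right mult.commute[of _ "norm (S u)"] add_mono mult_right_mono)
      then show ?thesis
        using orth[OF yz, of u] Cauchy_Schwarz_ineq2[of "E u" y] Cauchy_Schwarz_ineq2[of "F u" z] by linarith
    qed
    moreover have "linear (\<lambda>u. inner u y)"
      by (simp add: bounded_linear.linear bounded_linear_inner_left)
    ultimately obtain w where "\<And>u. inner u y = inner (S u) w"
      using weak_riesz[OF linear_if_mem[OF S]] by metis
    then have "y = S w"
      by (simp add: S_sa vector_eq_ldot[of y, symmetric])
    then show "y \<in> range S" by blast
  qed
qed

end

section \<open>Graphs of quotients, adjoints and Kaufman inverses\<close>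

lemma inner_closure_eqI:
  assumes "\<And>s. s \<in> S \<Longrightarrow> inner s z = inner s z'" "x \<in> closure S"
  shows "inner x z = inner x z'"
proof -
  have "closed {s. inner s z = inner s z'}"
    by (intro closed_Collect_eq continuous_intros)
  then have "closure S \<subseteq> {s. inner s z = inner s z'}"
    using assms(1) by (intro closure_minimal) auto
  with assms(2) show ?thesis by blast
qed

lemma closure_eqI:
  assumes eq: "\<And>s. s \<in> S \<Longrightarrow> inner s z = inner s z'" and "z \<in> closure S" "z' \<in> closure S"
  shows "z = z'"
proof -
  have "inner (z - z') (z - z') = 0"
    using inner_closure_eqI[OF eq assms(2)] inner_closure_eqI[OF eq assms(3)]
    by (simp add: inner_diff_left inner_diff_right)
  then show ?thesis by simp
qed

text \<open>Used later with \<open>b = bounded_adjoint B\<close> and \<open>b' = B\<close>, in this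
  order, so that the closed range of interest is the orthogonal complement of the null space of
  \<open>b\<close>.\<close>

locale adjoint_pair =
  fixes b b' :: "'a::complex_hilbert_space \<Rightarrow> 'a"
  assumes b: "bounded_clinear b"
    and inner_adj: "inner (b x) y = inner x (b' y)"
begin

lemma lin: "linear b"
  by (rule linear_bounded_clinear[OF b])

lemma inner_adj': "inner (b' x) y = inner x (b y)"
  by (metis inner_adj inner_commute)

lemma lin': "linear b'"
proof (rule linearI)
  show "b' (x + y) = b' x + b' y" for x y
    by (rule vector_eq_ldot[THEN iffD1]) (simp add: inner_add_right flip: inner_adj)
  show "b' (r *\<^sub>R x) = r *\<^sub>R b' x" for r x
    by (rule vector_eq_ldot[THEN iffD1]) (simp flip: inner_adj)
qed

lemma closure_range_adj_inner:
  assumes "z \<in> closure (range b')" "b n = 0"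
  shows "inner z n = 0"
proof -
  have "inner s n = inner s 0" if "s \<in> range b'" for s
    using that assms(2) by (auto simp: inner_adj')
  then show ?thesis using inner_closure_eqI[of "range b'" n 0 z] assms(1) by simp
qed

text \<open>\<open>weak_riesz\<close> for \<open>b'\<close> and the functional
  \<open>inner (b' u) x\<close> of \<open>u\<close> gives the projection of \<open>x\<close> onto
  the closure of the range; the rest is orthogonal to that range, hence killed by
  \<open>b\<close>.\<close>

lemma decompose:
  obtains z where "z \<in> closure (range b')" "b (x - z) = 0"
proof -
  have "\<bar>inner (b' u) x\<bar> \<le> norm x * norm (b' u)" for u
    using Cauchy_Schwarz_ineq2[of "b' u" x] by (simp add: mult.commute)
  moreover have "linear (\<lambda>u. inner (b' u) x)"
    by (auto intro!: linearI simp: linear_add[OF lin'] linear_scale[OF lin'] inner_add_left)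
  ultimately obtain z where z: "z \<in> closure (range b')" "\<And>u. inner (b' u) x = inner (b' u) z"
    using weak_riesz[OF lin'] by metis
  have "\<forall>u. inner u (b x) = inner u (b z)"
    using z(2) by (simp add: inner_adj')
  then have "b (x - z) = 0"
    by (simp add: vector_eq_ldot linear_diff[OF lin])
  with z(1) show ?thesis by (rule that)
qed

lemma closure_range_adj_iff: "z \<in> closure (range b') \<longleftrightarrow> (\<forall>n. b n = 0 \<longrightarrow> inner z n = 0)"
proof
  assume orth: "\<forall>n. b n = 0 \<longrightarrow> inner z n = 0"
  obtain w where w: "w \<in> closure (range b')" "b (z - w) = 0" by (rule decompose)
  then have "inner (z - w) (z - w) = 0"
    using orth closure_range_adj_inner[OF w] by (simp add: inner_diff_left)
  then show "z \<in> closure (range b')" using w(1) by simp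
qed (use closure_range_adj_inner in blast)

lemma null_proj:
  shows "b (null_proj (Some \<circ> b) x) = 0"
    and "b n = 0 \<Longrightarrow> inner (x - null_proj (Some \<circ> b) x) n = 0"
proof -
  obtain z where z: "z \<in> closure (range b')" "b (x - z) = 0" by (rule decompose)
  have "bounded_linear b" using b by (simp add: bounded_clinear_def)
  then have "closed {x. b x = 0}"
    by (intro closed_Collect_eq continuous_intros linear_continuous_on)
  then have null: "closure (op_null (Some \<circ> b)) = {x. b x = 0}"
    by (simp add: op_null_def)
  \<comment> \<open>The null space of \<open>b\<close> is closed under complex scaling, so real
    orthogonality to \<open>n\<close> and to \<open>- \<i> *\<^sub>C n\<close> gives complex
    orthogonality.\<close>
  have orth: "cinner z n = 0" if "b n = 0" for n
  proof -
    have "b (- \<i> *\<^sub>C n) = - \<i> *\<^sub>C b n" using b by (simp add: bounded_clinear_def)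
    also have "\<dots> = 0" using that linear_0[OF bounded_linear.linear[OF bounded_linear_scaleC]] by simp
    finally have "inner n z = 0" "inner (- \<i> *\<^sub>C n) z = 0"
      using closure_range_adj_inner[OF z(1)] that by (simp_all add: inner_commute[of _ z])
    then have "cinner n z = 0"
      by (simp add: complex_eq_iff Re_cinner Im_cinner)
    then show ?thesis using cinner_commute[of z n] by simp
  qed
  have "null_proj (Some \<circ> b) x = x - z"
    unfolding null_proj_def orth_proj_def null
  proof (rule the_equality)
    fix p assume p: "p \<in> {x. b x = 0} \<and> (\<forall>s\<in>{x. b x = 0}. cinner (x - p) s = 0)"
    define d where "d = x - z - p"
    have "b d = 0" using p z(2) by (simp add: d_def linear_diff[OF lin])
    then have "cinner (x - p) d = 0" "cinner z d = 0"
      using p orth by blast+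
    then have "inner (x - p) d = 0" "inner z d = 0"
      by (simp_all flip: Re_cinner)
    then have "inner d d = 0" by (simp add: d_def inner_diff_left)
    then show "p = x - z" by (simp add: d_def)
  qed (use z orth in auto)
  then show "b (null_proj (Some \<circ> b) x) = 0"
    and "b n = 0 \<Longrightarrow> inner (x - null_proj (Some \<circ> b) x) n = 0"
    using z closure_range_adj_inner[OF z(1)] by simp_all
qed

lemma null_orth_unique:
  assumes "b u = b v" "\<forall>n. b n = 0 \<longrightarrow> inner u n = 0" "\<forall>n. b n = 0 \<longrightarrow> inner v n = 0"
  shows "u = v"
proof -
  have "b (u - v) = 0" using assms(1) by (simp add: linear_diff[OF lin])
  then have "inner (u - v) (u - v) = 0" using assms(2,3) by (simp add: inner_diff_left)
  then show ?thesis by simp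
qed

text \<open>Subtracting the null projection leaves the image under \<open>b\<close> unchanged, and
  \<open>null_orth_unique\<close> makes the result depend on \<open>y\<close> alone.\<close>

lemma kaufman_inverse_eq_Some_iff:
  "kaufman_inverse (Some \<circ> b) y = Some z \<longleftrightarrow> b z = y \<and> (\<forall>n. b n = 0 \<longrightarrow> inner z n = 0)"
proof (cases "y \<in> range b")
  case True
  then obtain x where x: "y = b x" by blast
  define w where "w = x - null_proj (Some \<circ> b) x"
  have val: "b (u - null_proj (Some \<circ> b) u) = b u" for u
    by (simp add: linear_diff[OF lin] null_proj)
  have unique: "u - null_proj (Some \<circ> b) u = w" if "b u = y" for u
    by (rule null_orth_unique) (use that x in \<open>auto simp: w_def val null_proj\<close>)
  have "(THE z. \<exists>u. (Some \<circ> b) u = Some y \<and> z = u - null_proj (Some \<circ> b) u) = w"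
    using x by (intro the_equality) (auto simp: unique)
  moreover have "y \<in> ran (Some \<circ> b)" using x by (auto simp: ran_def)
  ultimately have "kaufman_inverse (Some \<circ> b) y = Some w"
    by (simp add: kaufman_inverse_def)
  moreover have w: "b w = y" "\<forall>n. b n = 0 \<longrightarrow> inner w n = 0"
    using val x by (simp_all add: w_def null_proj)
  ultimately show ?thesis using null_orth_unique[of w z] by (metis option.inject)
next
  case False
  then have "y \<notin> ran (Some \<circ> b)" by (auto simp: ran_def)
  then show ?thesis using False by (auto simp: kaufman_inverse_def)
qed

end

section \<open>Quotients and the graphs of their adjoints\<close>

lemma quotient_op_apply:
  assumes "linear A" "linear B" "null_space B \<subseteq> null_space A"
  shows "quotient_op A B (B x) = Some (A x)"
proof -
  have "A x' = A x" if "B x' = B x" for x'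
  proof -
    have "x' - x \<in> null_space B"
      using that assms(2) by (simp add: null_space_def linear_diff)
    then have "A (x' - x) = 0" using assms(3) by (auto simp: null_space_def)
    then show ?thesis using assms(1) by (simp add: linear_diff)
  qed
  then have "(THE z. \<exists>x'. B x' = B x \<and> z = A x') = A x"
    by (intro the_equality) blast+
  then show ?thesis by (simp add: quotient_op_def)
qed

lemma dom_quotient_op: "dom (quotient_op A B) = range B"
  by (auto simp: quotient_op_def dom_def)

lemma quotient_op_eq_Some_iff:
  assumes "linear A" "linear B" "null_space B \<subseteq> null_space A"
  shows "quotient_op A B y = Some z \<longleftrightarrow> (\<exists>x. y = B x \<and> z = A x)"
proof (cases "y \<in> range B")
  case False
  then show ?thesis by (auto simp: quotient_op_def)
qed (use quotient_op_apply[OF assms] in auto)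

text \<open>Continuity at 0 bounds \<open>inner (A x) y\<close> by a multiple of
  \<open>norm (B x)\<close>, which is the input of \<open>weak_riesz\<close>. Conversely, such a
  \<open>z\<close> turns the functional into \<open>cinner u z\<close>, which is continuous in
  \<open>u\<close>.\<close>

lemma op_adjoint_quotient_eq_Some_iff:
  assumes A: "bounded_clinear A" and B: "bounded_clinear B" and null: "null_space B \<subseteq> null_space A"
  shows "op_adjoint (quotient_op A B) y = Some z \<longleftrightarrow>
    z \<in> closure (range B) \<and> (\<forall>x. inner (A x) y = inner (B x) z)" (is "_ \<longleftrightarrow> ?R z")
proof -
  note lin = linear_bounded_clinear[OF A] linear_bounded_clinear[OF B]
  define T where "T = quotient_op A B"
  have T: "the (T (B x)) = A x" for x
    using quotient_op_apply[OF lin null] by (simp add: T_def)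
  have dom: "dom T = range B" by (simp add: T_def dom_quotient_op)
  have Some_if: "op_adjoint T y = Some z" if z: "?R z" for z
  proof -
    have eq: "cinner (A x) y = cinner (B x) z" for x
      using z by (intro cinner_eq_if_inner_eq[OF A B]) auto
    have "continuous_on (range B) (\<lambda>u. cinner u z)"
      by (auto simp: continuous_on_def intro!: tendsto_cinner_left tendsto_ident_at)
    then have "continuous_on (dom T) (\<lambda>u. cinner (the (T u)) y)"
      unfolding dom by (rule continuous_on_eq) (auto simp: T eq)
    moreover have "(THE z. z \<in> closure (dom T) \<and> (\<forall>x\<in>dom T. cinner (the (T x)) y = cinner x z)) = z"
      unfolding dom
    proof (rule the_equality)
      fix w assume w: "w \<in> closure (range B) \<and> (\<forall>x\<in>range B. cinner (the (T x)) y = cinner x w)"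
      show "w = z"
      proof (rule closure_eqI[of "range B"])
        fix s assume "s \<in> range B"
        then show "inner s w = inner s z"
          using w eq by (intro inner_eq_if_cinner_eq) (auto simp: T)
      qed (use w z in auto)
    qed (use z in \<open>auto simp: T eq\<close>)
    ultimately show ?thesis by (simp add: op_adjoint_def)
  qed
  have ex: "\<exists>z. ?R z" if "op_adjoint T y \<noteq> None"
  proof -
    have "continuous_on (range B) (\<lambda>u. cinner (the (T u)) y)"
      using that by (auto simp: op_adjoint_def dom split: if_splits)
    moreover have "0 \<in> range B" using linear_0[OF lin(2)] by (metis rangeI)
    ultimately obtain \<delta> where \<delta>: "\<delta> > 0"
      "\<And>u. u \<in> range B \<Longrightarrow> dist u 0 < \<delta> \<Longrightarrow> dist (cinner (the (T u)) y) (cinner (the (T 0)) y) < 1"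
      unfolding continuous_on_iff by (metis zero_less_one)
    have "the (T 0) = 0" using T[of 0] by (simp add: linear_0 lin)
    moreover have "cinner 0 y = 0" by (simp add: complex_eq_iff Re_cinner Im_cinner
          linear_0[OF bounded_linear.linear[OF bounded_linear_scaleC]])
    ultimately have small: "\<bar>inner (A x) y\<bar> \<le> 1" if "norm (B x) < \<delta>" for x
      using \<delta>(2)[of "B x"] that abs_Re_le_cmod[of "cinner (A x) y"] by (simp add: T Re_cinner)
    have "\<bar>inner (A x) y\<bar> \<le> (2 / \<delta>) * norm (B x)" for x
    proof (cases "B x = 0")
      case True
      then have "A x = 0" using null by (auto simp: null_space_def)
      then show ?thesis using \<delta>(1) by simp
    next
      case False
      \<comment> \<open>Rescales \<open>x\<close> so that \<open>B (r *\<^sub>R x)\<close> has norm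
        \<open>\<delta> / 2\<close>, within reach of \<open>small\<close>.\<close>
      define r where "r = \<delta> / (2 * norm (B x))"
      have r: "r > 0" using False \<delta>(1) by (simp add: r_def)
      have "norm (B (r *\<^sub>R x)) < \<delta>"
        using False \<delta>(1) by (simp add: linear_scale lin r_def)
      from small[OF this] have "r * \<bar>inner (A x) y\<bar> \<le> 1"
        using r by (simp add: linear_scale lin abs_mult)
      then show ?thesis using False \<delta>(1) by (simp add: r_def field_simps)
    qed
    moreover have "linear (\<lambda>x. inner (A x) y)"
      by (auto intro!: linearI simp: linear_add linear_scale lin inner_add_left)
    ultimately show ?thesis
      using weak_riesz[OF lin(2), of "\<lambda>x. inner (A x) y"] by metis
  qed
  show ?thesis
    using Some_if ex unfolding T_def by (metis option.discI option.inject)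
qed

section \<open>Adjoints of quotients from a von Neumann algebra\<close>

context von_neumann
begin

lemma adjoint_pair:
  assumes "A \<in> M"
  shows "adjoint_pair (bounded_adjoint A) A"
proof
  show "bounded_clinear (bounded_adjoint A)"
    by (intro bounded_clinear_if_mem adjoint_mem assms)
  show "inner (bounded_adjoint A x) y = inner x (A y)" for x y
    by (metis inner_bounded_adjoint bounded_clinear_if_mem assms inner_commute)
qed

text \<open>Moving \<open>A\<close> and \<open>B\<close> to the other side turns the functional
  identity into an equation, and the closure of the range of \<open>B\<close> is the orthogonal
  complement of the null space of its adjoint.\<close>

lemma op_adjoint_graph:
  assumes A: "A \<in> M" and B: "B \<in> M" and null: "null_space B \<subseteq> null_space A"
  shows "op_adjoint (quotient_op A B) y = Some z \<longleftrightarrow> bounded_adjoint B z = bounded_adjoint A y \<and>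
    (\<forall>n. bounded_adjoint B n = 0 \<longrightarrow> inner z n = 0)"
proof -
  have "(\<forall>x. inner (A x) y = inner (B x) z) \<longleftrightarrow> bounded_adjoint A y = bounded_adjoint B z"
    by (simp add: inner_bounded_adjoint bounded_clinear_if_mem A B vector_eq_ldot)
  then show ?thesis
    using op_adjoint_quotient_eq_Some_iff[OF bounded_clinear_if_mem[OF A] bounded_clinear_if_mem[OF B] null]
      adjoint_pair.closure_range_adj_iff[OF adjoint_pair[OF B]] by auto
qed

text \<open>Both sides have the same graph, by \<open>op_adjoint_graph\<close> and
  \<open>kaufman_inverse_eq_Some_iff\<close>; this settles the domains as well.\<close>

lemma op_adjoint_quotient:
  assumes A: "A \<in> M" and B: "B \<in> M" and null: "null_space B \<subseteq> null_space A"
  shows "op_adjoint (quotient_op A B) =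
    kaufman_inverse (Some \<circ> bounded_adjoint B) \<circ>\<^sub>m (Some \<circ> bounded_adjoint A)"
proof
  fix y
  have "op_adjoint (quotient_op A B) y = Some z \<longleftrightarrow>
      kaufman_inverse (Some \<circ> bounded_adjoint B) (bounded_adjoint A y) = Some z" for z
    unfolding op_adjoint_graph[OF assms] adjoint_pair.kaufman_inverse_eq_Some_iff[OF adjoint_pair[OF B]] ..
  then have "op_adjoint (quotient_op A B) y =
      kaufman_inverse (Some \<circ> bounded_adjoint B) (bounded_adjoint A y)"
    by (metis not_None_eq)
  then show "op_adjoint (quotient_op A B) y =
      (kaufman_inverse (Some \<circ> bounded_adjoint B) \<circ>\<^sub>m (Some \<circ> bounded_adjoint A)) y"
    by (simp add: map_comp_def)
qed

lemma op_adjoint_affiliated: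
  assumes A: "A \<in> M" and B: "B \<in> M" and null: "null_space B \<subseteq> null_space A"
  shows "op_adjoint (quotient_op A B) \<in> affiliated_quotients M"
proof -
  interpret adjoint_pair "bounded_adjoint B" B by (rule adjoint_pair[OF B])
  obtain S C where SC: "S \<in> M" "C \<in> M" "\<And>x. bounded_adjoint A (S x) = bounded_adjoint B (C x)"
    "\<And>x n. bounded_adjoint B n = 0 \<Longrightarrow> inner (C x) n = 0"
    "\<And>y z. bounded_adjoint A y = bounded_adjoint B z \<Longrightarrow> y \<in> range S"
    using graph_parametrization[OF adjoint_mem[OF A] A adjoint_mem[OF B] B
        adjoint_pair.inner_adj[OF adjoint_pair[OF A]] inner_adj] by metis
  \<comment> \<open>\<open>C x\<close> then lies in the null space of
    \<open>bounded_adjoint B\<close> and is also orthogonal to it.\<close>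
  have "C x = 0" if "S x = 0" for x
    using that SC(3)[of x] SC(4)[of "C x" x]
    by (simp add: linear_0 linear_if_mem adjoint_mem A)
  then have null_SC: "null_space S \<subseteq> null_space C" by (auto simp: null_space_def)
  have "op_adjoint (quotient_op A B) y = Some z \<longleftrightarrow> quotient_op C S y = Some z" for y z
    unfolding op_adjoint_graph[OF assms]
      quotient_op_eq_Some_iff[OF linear_if_mem[OF SC(2)] linear_if_mem[OF SC(1)] null_SC]
  proof
    assume z: "bounded_adjoint B z = bounded_adjoint A y \<and> (\<forall>n. bounded_adjoint B n = 0 \<longrightarrow> inner z n = 0)"
    then obtain x where x: "y = S x" using SC(5)[of y z] by auto
    have "z = C x"
      by (rule null_orth_unique) (use x z SC(3,4) in auto)
    with x show "\<exists>x. y = S x \<and> z = C x" by blast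
  qed (use SC(3,4) in auto)
  then have "op_adjoint (quotient_op A B) y = quotient_op C S y" for y
    by (metis not_None_eq)
  then have "op_adjoint (quotient_op A B) = quotient_op C S" by (rule ext)
  then show ?thesis using SC(1,2) null_SC by (auto simp: affiliated_quotients_def)
qed

end

theorem theorem4p10:
  fixes M :: "('a::complex_hilbert_space \<Rightarrow> 'a) set"
  assumes "von_neumann_algebra M"
  shows "(\<forall>A\<in>M. \<forall>B\<in>M. null_space B \<subseteq> null_space A \<longrightarrow>
            op_adjoint (quotient_op A B) =
              kaufman_inverse (Some \<circ> bounded_adjoint B) \<circ>\<^sub>m (Some \<circ> bounded_adjoint A)) \<and>
         (\<forall>T\<in>affiliated_quotients M. op_adjoint T \<in> affiliated_quotients M)"
proof -
  interpret von_neumann M by (rule von_neumann.intro[OF assms])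
  have "op_adjoint T \<in> affiliated_quotients M" if "T \<in> affiliated_quotients M" for T
    using that op_adjoint_affiliated unfolding affiliated_quotients_def[of M] by blast
  then show ?thesis using op_adjoint_quotient by blast
qed

end
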